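(* Let $n\ge1$ and $m\ge1$ be integers, and let $W_{(n,m)}$ be the linear map on polynomials of degree at most $n-1$ defined by $W_{(n,m)}c=\tilde U_n\big(m\,d(mx)\big)$ where $d=\tilde U_n^{-1}c$ (i.e. $W_{(n,m)}=\tilde U_n(m,mx)\tilde U_n^{-1}$). Then for every polynomial $c(x)$ of degree at most $n-1$ and every $0\le i\le n-1$, $$[x^i]\,W_{(n,m)}c(x)=[x^{mi+m-1}]\Big(w_m^{n+1}(x)\,c(x)\Big),\qquad w_m(x)=\frac{1-x^m}{1-x}=1+x+\cdots+x^{m-1}.$$ Equivalently, $W_{(n,m)}$ has matrix entries $(W_{(n,m)})_{i,j}=[x^{mi+m-1-j}]\,w_m^{n+1}(x)$, $0\le i,j\le n-1$.
   Context: Polynomials over $\mathbb{C}$; $(y)_p=y(y-1)\cdots(y-p+1)$, $[y]_k=y(y+1)\cdots(y+k-1)$. $\tilde U_n$ is the linear map on polynomials of degree at most $n-1$ with $\tilde U_nx^p=\frac{(1-x)^{n+1}}{n!}\sum_{j\ge0}(j+1)^{p+1}x^j$ ($0\le p\le n-1$); it is invertible with $\tilde U_n^{-1}x^p=(x-1)_p[x+1]_{n-p-1}$. The Riordan matrix $(m,mx)$ acts as $c(x)\mapsto m\,c(mx)$. *)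

theory Defs
  imports Complex_Main "HOL-Computational_Algebra.Computational_Algebra"
begin

definition polys_below :: "nat \<Rightarrow> complex poly set" where
  "polys_below n = {c. degree c \<le> n - 1}"

text \<open>\<open>y(y-1)...(y-p+1)\<close> and \<open>y(y+1)...(y+k-1)\<close> for a polynomial \<open>y\<close>.\<close>

definition falling :: "complex poly \<Rightarrow> nat \<Rightarrow> complex poly" where
  "falling y p = (\<Prod>i<p. y - of_nat i)"

definition rising :: "complex poly \<Rightarrow> nat \<Rightarrow> complex poly" where
  "rising y k = (\<Prod>i<k. y + of_nat i)"

definition U_series :: "nat \<Rightarrow> nat \<Rightarrow> complex fps" where
  "U_series n p = fps_const (1 / fact n) * (1 - fps_X) ^ (n + 1)
                    * Abs_fps (\<lambda>j. (of_nat j + 1) ^ (p + 1))"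

text \<open>For \<open>p < n\<close> the series \<open>U_series n p\<close> is a polynomial of degree at most \<open>n - 1\<close>
  (lemma \<open>fps_of_poly_U_mono\<close>), so the description below is meaningful.\<close>

definition U_mono :: "nat \<Rightarrow> nat \<Rightarrow> complex poly" where
  "U_mono n p = (THE q. fps_of_poly q = U_series n p)"

text \<open>The linear extension; only arguments in \<open>polys_below n\<close> are meaningful.\<close>

definition U_tilde :: "nat \<Rightarrow> complex poly \<Rightarrow> complex poly" where
  "U_tilde n c = (\<Sum>p<n. smult (coeff c p) (U_mono n p))"

definition U_tilde_inv :: "nat \<Rightarrow> complex poly \<Rightarrow> complex poly" where
  "U_tilde_inv n = inv_into (polys_below n) (U_tilde n)"

text \<open>The Riordan matrix \<open>(m, mx)\<close>, acting by \<open>c(x) \<mapsto> m c(mx)\<close>.\<close>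

definition riordan :: "nat \<Rightarrow> complex poly \<Rightarrow> complex poly" where
  "riordan m c = smult (of_nat m) (pcompose c [:0, of_nat m:])"

definition W_map :: "nat \<Rightarrow> nat \<Rightarrow> complex poly \<Rightarrow> complex poly" where
  "W_map n m c = U_tilde n (riordan m (U_tilde_inv n c))"

definition w_poly :: "nat \<Rightarrow> complex poly" where
  "w_poly m = (\<Sum>k<m. monom 1 k)"

lemma w_poly_quotient: "w_poly m = (1 - monom 1 m) div (1 - monom 1 1)"
proof -
  have "[:1, -1:] * w_poly m = 1 - monom 1 m"
  proof (induction m)
    case (Suc m)
    have "w_poly (Suc m) = w_poly m + monom 1 m" by (simp add: w_poly_def)
    moreover have "[:1, -1:] * monom 1 m = (monom 1 m - monom 1 (Suc m) :: complex poly)"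
      by (simp add: monom_Suc)
    ultimately show ?case using Suc by (simp only: distrib_left) simp
  qed (simp add: w_poly_def)
  moreover have "1 - monom 1 1 = ([:1, -1:] :: complex poly)"
    by (simp add: monom_altdef one_pCons)
  ultimately show ?thesis
    by (metis nonzero_mult_div_cancel_left pCons_eq_0_iff one_neq_zero)
qed

text \<open>The facts that make these definitions meaningful: \<open>U_tilde n\<close> maps \<open>polys_below n\<close>
  bijectively to itself, and its inverse is given by the product formula on monomials.\<close>

definition shifted_powers :: "nat \<Rightarrow> complex fps" where
  "shifted_powers p = Abs_fps (\<lambda>j. (of_nat j + 1) ^ p)"

lemma shifted_powers_Suc: "shifted_powers (Suc p) = shifted_powers p + fps_X * fps_deriv (shifted_powers p)"
  by (rule fps_ext) (auto simp: shifted_powers_def fps_X_mult_nth algebra_simps of_nat_diff split: nat.splits)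

lemma shifted_powers_0: "shifted_powers 0 * (1 - fps_X) = 1"
  by (rule fps_ext) (auto simp: shifted_powers_def algebra_simps fps_X_mult_right_nth)

lemma eulerian_aux:
  fixes k X a a' y :: "'a :: comm_ring_1"
  shows "(1 + (k - 1) * X) * (a * (y * (1 - X))) + X * (1 - X) * (a' * (y * (1 - X)) - a * (k * y))
           = (a + X * a') * (y * (1 - X) * (1 - X))"
  by (simp add: algebra_simps)

lemma eulerian_poly:
  "\<exists>A. degree A \<le> p \<and> fps_of_poly A = shifted_powers (Suc p) * (1 - fps_X) ^ (p + 2)"
proof (induction p)
  case 0
  have "fps_deriv (shifted_powers 0) * (1 - fps_X) = shifted_powers 0"
    using arg_cong[OF shifted_powers_0, of fps_deriv] by (simp add: algebra_simps)
  then have "shifted_powers (Suc 0) * (1 - fps_X) ^ 2 = shifted_powers 0 * (1 - fps_X) * (1 - fps_X) + fps_X * (shifted_powers 0 * (1 - fps_X))"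
    unfolding shifted_powers_Suc power2_eq_square by (simp add: distrib_right mult.assoc)
  then show ?case using shifted_powers_0 by (intro exI[of _ 1]) (auto simp: numeral_2_eq_2)
next
  case (Suc p)
  then obtain A where A: "degree A \<le> p" "fps_of_poly A = shifted_powers (Suc p) * (1 - fps_X) ^ (p + 2)"
    by blast
  define X :: "complex fps" where "X = fps_X"
  define k :: "complex fps" where "k = of_nat (p + 2)"
  define B where "B = [:1, of_nat (Suc p):] * A + [:0, 1, -1:] * pderiv A"
  have "degree B \<le> Suc p"
  proof -
    have "degree ([:1, of_nat (Suc p):] * A) \<le> Suc p"
      by (rule order_trans[OF degree_mult_le]) (use A in auto)
    moreover have "degree ([:0, 1, -1:] * pderiv A) \<le> Suc p"
    proof (cases "degree A = 0")
      case True
      then have "pderiv A = 0" by (simp add: pderiv_eq_0_iff)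
      then show ?thesis by simp
    next
      case False
      then show ?thesis
        by (intro order_trans[OF degree_mult_le]) (use A in \<open>auto simp: degree_pderiv\<close>)
    qed
    ultimately show ?thesis unfolding B_def by (intro degree_add_le)
  qed
  moreover have "fps_of_poly B = shifted_powers (Suc (Suc p)) * (1 - fps_X) ^ (Suc p + 2)"
  proof -
    have l1: "fps_of_poly [:1, of_nat (Suc p):] = 1 + (k - 1) * X"
      by (simp add: fps_of_poly_linear' k_def X_def fps_of_nat flip: fps_of_nat)
    have l2: "fps_of_poly [:0, 1, -1:] = X * (1 - X)"
      by (simp add: fps_of_poly_pCons X_def algebra_simps)
    define a where "a = shifted_powers (Suc p)"
    define a' where "a' = fps_deriv a"
    define y where "y = (1 - X) ^ (p + 1)"
    have fA: "fps_of_poly A = a * (y * (1 - X))"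
      by (simp add: A a_def X_def y_def)
    have dy: "fps_deriv (y * (1 - X)) = - (k * y)"
    proof -
      have "y * (1 - X) = (1 - X) ^ (p + 2)" by (simp add: y_def)
      moreover have "fps_deriv ((1 - X) ^ (p + 2)) = of_nat (p + 2) * fps_deriv (1 - X) * (1 - X) ^ (p + 1)"
        by (simp only: fps_deriv_power fps_of_nat) simp
      moreover have "fps_deriv (1 - X) = -1" by (simp add: X_def)
      ultimately show ?thesis by (simp only: k_def y_def mult_minus1_right mult_minus_left)
    qed
    have fA': "fps_of_poly (pderiv A) = a' * (y * (1 - X)) - a * (k * y)"
      unfolding fps_of_poly_pderiv fA fps_deriv_mult[of a] dy a'_def by (simp add: algebra_simps)
    have "fps_of_poly B = (1 + (k - 1) * X) * (a * (y * (1 - X)))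
        + X * (1 - X) * (a' * (y * (1 - X)) - a * (k * y))"
      by (simp only: B_def fps_of_poly_add fps_of_poly_mult l1 l2 fA fA')
    also have "\<dots> = (a + X * a') * (y * (1 - X) * (1 - X))"
      by (rule eulerian_aux)
    also have "\<dots> = shifted_powers (Suc (Suc p)) * (1 - fps_X) ^ (Suc p + 2)"
      by (simp add: shifted_powers_Suc[of "Suc p"] a_def a'_def X_def y_def)
    finally show ?thesis .
  qed
  ultimately show ?case by blast
qed

lemma U_mono:
  assumes "p < n"
  shows fps_of_poly_U_mono: "fps_of_poly (U_mono n p) = U_series n p"
    and degree_U_mono: "degree (U_mono n p) \<le> n - 1"
proof -
  obtain A where A: "degree A \<le> p" "fps_of_poly A = shifted_powers (Suc p) * (1 - fps_X) ^ (p + 2)"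
    using eulerian_poly by blast
  define q where "q = smult (1 / fact n) (A * [:1, -1:] ^ (n - 1 - p))"
  have n: "n + 1 = (p + 2) + (n - 1 - p)" using assms by simp
  have "fps_of_poly [:1, -1::complex:] = 1 - fps_X"
    by (simp add: fps_of_poly_linear')
  then have "fps_of_poly q
      = fps_const (1 / fact n) * (shifted_powers (Suc p) * (1 - fps_X) ^ (p + 2) * (1 - fps_X) ^ (n - 1 - p))"
    by (simp only: q_def fps_of_poly_smult fps_of_poly_mult fps_of_poly_power A)
  then have q: "fps_of_poly q = U_series n p"
    unfolding U_series_def n power_add shifted_powers_def Suc_eq_plus1 by (simp only: mult_ac)
  then have *: "U_mono n p = q"
    unfolding U_mono_def by (intro the_equality) (auto simp flip: fps_of_poly_eq_iff)
  show "fps_of_poly (U_mono n p) = U_series n p" using q * by simp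
  have "degree q \<le> degree A + degree ([:1, -1::complex:] ^ (n - 1 - p))"
    unfolding q_def by (rule order_trans[OF degree_smult_le degree_mult_le])
  also have "\<dots> \<le> p + (n - 1 - p)"
    using A degree_power_le[of "[:1, -1::complex:]" "n - 1 - p"] by (intro add_mono) auto
  finally show "degree (U_mono n p) \<le> n - 1" using * assms by simp
qed

lemma U_tilde_closed: "U_tilde n c \<in> polys_below n"
  unfolding U_tilde_def polys_below_def
  by (auto intro!: degree_sum_le order_trans[OF degree_smult_le] simp del: One_nat_def simp: degree_U_mono)

lemma fps_of_poly_U_tilde:
  assumes "n \<ge> 1" "c \<in> polys_below n"
  shows "fps_of_poly (U_tilde n c) = fps_const (1 / fact n) * (1 - fps_X) ^ (n + 1)
           * Abs_fps (\<lambda>j. (of_nat j + 1) * poly c (of_nat j + 1))"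
proof -
  have deg: "degree c < n" using assms by (auto simp: polys_below_def)
  have "poly c x = (\<Sum>p<n. coeff c p * x ^ p)" for x
    unfolding poly_altdef using deg
    by (intro sum.mono_neutral_left) (auto simp: coeff_eq_0)
  then have "Abs_fps (\<lambda>j. (of_nat j + 1) * poly c (of_nat j + 1))
      = (\<Sum>p<n. fps_const (coeff c p) * Abs_fps (\<lambda>j. (of_nat j + 1) ^ (p + 1)))"
    by (intro fps_ext) (simp add: fps_sum_nth sum_distrib_left mult_ac)
  then show ?thesis
    by (simp add: U_tilde_def fps_of_poly_sum fps_of_poly_smult fps_of_poly_U_mono U_series_def
        sum_distrib_left mult_ac)
qed

lemma inj_on_U_tilde:
  assumes "n \<ge> 1"
  shows "inj_on (U_tilde n) (polys_below n)"
proof (rule inj_onI)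
  fix c d assume cd: "c \<in> polys_below n" "d \<in> polys_below n" "U_tilde n c = U_tilde n d"
  have nz: "fps_const (1 / fact n :: complex) * (1 - fps_X) ^ (n + 1) \<noteq> 0"
  proof -
    have "(1 - fps_X :: complex fps) $ 0 \<noteq> 0" by simp
    then have "1 - fps_X \<noteq> (0 :: complex fps)" by (metis fps_zero_nth)
    then show ?thesis by simp
  qed
  define F :: "complex poly \<Rightarrow> complex fps" where
    "F q = Abs_fps (\<lambda>j. (of_nat j + 1) * poly q (of_nat j + 1))" for q
  have "fps_const (1 / fact n) * (1 - fps_X) ^ (n + 1) * F c
      = fps_const (1 / fact n) * (1 - fps_X) ^ (n + 1) * F d"
    unfolding F_def fps_of_poly_U_tilde[OF assms cd(1), symmetric]
      fps_of_poly_U_tilde[OF assms cd(2), symmetric] cd(3) ..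
  then have "F c = F d"
    by (simp only: mult_left_cancel[OF nz])
  then have "F c $ j = F d $ j" for j by simp
  moreover have "of_nat j + 1 \<noteq> (0 :: complex)" for j
    by (metis of_nat_Suc of_nat_neq_0 add.commute)
  ultimately have eq: "poly c (of_nat j + 1) = poly d (of_nat j + 1)" for j
    unfolding F_def fps_nth_Abs_fps by (metis mult_left_cancel)
  have "infinite (range (\<lambda>j. of_nat j + 1 :: complex))"
    by (rule range_inj_infinite) (auto simp: inj_on_def)
  moreover have "range (\<lambda>j. of_nat j + 1 :: complex) \<subseteq> {x. poly (c - d) x = 0}"
    using eq by auto
  ultimately have "c - d = 0"
    using poly_roots_finite finite_subset by blast
  then show "c = d" by simp
qed

lemma binomial_series:
  "(1 - fps_X) ^ (n + 1) * Abs_fps (\<lambda>k. of_nat ((n + k) choose n)) = (1 :: complex fps)"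
proof (induction n)
  case 0
  show ?case by (rule fps_ext) (auto simp: algebra_simps)
next
  case (Suc n)
  have "(1 - fps_X) * Abs_fps (\<lambda>k. of_nat ((Suc n + k) choose Suc n))
      = (Abs_fps (\<lambda>k. of_nat ((n + k) choose n)) :: complex fps)"
  proof (rule fps_ext)
    fix k
    show "((1 - fps_X) * Abs_fps (\<lambda>k. of_nat ((Suc n + k) choose Suc n))) $ k
        = (Abs_fps (\<lambda>k. of_nat ((n + k) choose n)) :: complex fps) $ k"
      by (cases k) (auto simp: left_diff_distrib fps_X_mult_nth)
  qed
  then show ?case using Suc.IH by (simp only: power_Suc2 add_Suc mult.assoc)
qed

lemma U_tilde_product_formula:
  assumes "p < n"
  shows "falling [:-1, 1:] p * rising [:1, 1:] (n - p - 1) \<in> polys_below n"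
    and "U_tilde n (falling [:-1, 1:] p * rising [:1, 1:] (n - p - 1)) = monom 1 p"
proof -
  let ?q = "falling [:-1, 1:] p * rising [:1, 1:] (n - p - 1)"
  have "degree (falling [:-1, 1:] p) \<le> (\<Sum>i<p. 1)"
    unfolding falling_def
    by (rule order_trans[OF degree_prod_sum_le]) (auto simp: of_nat_poly intro!: sum_mono)
  moreover have "degree (rising [:1, 1:] (n - p - 1)) \<le> (\<Sum>i<n - p - 1. 1)"
    unfolding rising_def
    by (rule order_trans[OF degree_prod_sum_le]) (auto simp: of_nat_poly intro!: sum_mono)
  ultimately show q: "?q \<in> polys_below n"
    unfolding polys_below_def using assms
    by (auto intro!: order_trans[OF degree_mult_le])
  have val: "(of_nat j + 1) * poly ?q (of_nat j + 1)
      = fact n * (if j < p then 0 else of_nat ((n + (j - p)) choose n))" for j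
  proof -
    have f: "poly (falling [:-1, 1:] p) (of_nat j + 1) = (\<Prod>i<p. of_nat j - of_nat i)"
      by (simp add: falling_def poly_prod)
    have r: "poly (rising [:1, 1:] (n - p - 1)) (of_nat j + 1) = (\<Prod>i<n - p - 1. of_nat (j + 2 + i))"
      by (simp add: rising_def poly_prod algebra_simps)
    have r': "(of_nat j + 1) * (\<Prod>i<n - p - 1. of_nat (j + 2 + i) :: complex)
        = (\<Prod>i<n - p. of_nat (j + 1 + i))"
    proof -
      obtain k where "n - p = Suc k" using assms by (metis Suc_diff_Suc)
      then show ?thesis
        by (simp add: prod.lessThan_Suc_shift add_ac del: prod.lessThan_Suc)
    qed
    show ?thesis
    proof (cases "j < p")
      case True
      then have "(\<Prod>i<p. of_nat j - of_nat i :: complex) = 0" by (intro prod_zero) auto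
      then show ?thesis using f True by simp
    next
      case False
      then have "p \<le> j" by simp
      have F: "fact (j - p) * (\<Prod>i<p. of_nat j - of_nat i) = (fact j :: complex)"
        using \<open>p \<le> j\<close>
      proof (induction p)
        case (Suc p)
        then have "fact (j - p) = (of_nat j - of_nat p) * (fact (j - Suc p) :: complex)"
          by (subst fact_reduce) (auto simp: of_nat_diff)
        then show ?case using Suc by (simp add: mult_ac)
      qed simp
      have R: "fact j * (\<Prod>i<k. of_nat (j + 1 + i)) = (fact (j + k) :: complex)" for k
      proof (induction k)
        case (Suc k)
        have "fact (j + Suc k) = fact (j + k) * (of_nat (j + 1 + k) :: complex)"
          by (simp add: mult.commute add_ac)
        then show ?case by (simp only: prod.lessThan_Suc Suc.IH [symmetric] mult.assoc)
      qed simp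
      have "fact n * fact (j - p) * ((n + (j - p)) choose n) = fact (n + (j - p))"
        using binomial_fact_lemma[of n "n + (j - p)"] by simp
      then have C: "fact n * fact (j - p) * of_nat ((n + (j - p)) choose n)
          = (fact (n + (j - p)) :: complex)"
        by (metis of_nat_fact of_nat_mult)
      have "n + (j - p) = j + (n - p)" using assms \<open>p \<le> j\<close> by simp
      then have "fact (j - p) * ((\<Prod>i<p. of_nat j - of_nat i) * (\<Prod>i<n - p. of_nat (j + 1 + i)))
          = fact (j - p) * (fact n * of_nat ((n + (j - p)) choose n) :: complex)"
        by (simp only: mult.assoc [symmetric] F R mult.commute[of "fact (j - p)" "fact n"] C[unfolded \<open>n + (j - p) = j + (n - p)\<close>])
      then have "(\<Prod>i<p. of_nat j - of_nat i) * (\<Prod>i<n - p. of_nat (j + 1 + i))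
          = (fact n * of_nat ((n + (j - p)) choose n) :: complex)"
        by simp
      then show ?thesis
        using False by (simp only: poly_mult f r if_False r' [symmetric] mult_ac)
    qed
  qed
  show "U_tilde n ?q = monom 1 p"
  proof (subst fps_of_poly_eq_iff [symmetric])
    define B :: "complex fps" where "B = Abs_fps (\<lambda>k. of_nat ((n + k) choose n))"
    have "Abs_fps (\<lambda>j. (of_nat j + 1) * poly ?q (of_nat j + 1)) = fps_const (fact n) * (fps_X ^ p * B)"
      unfolding val by (rule fps_ext) (simp add: fps_X_power_mult_nth B_def)
    then have "fps_of_poly (U_tilde n ?q) = fps_const (1 / fact n) * (1 - fps_X) ^ (n + 1)
        * (fps_const (fact n) * (fps_X ^ p * B))"
      using fps_of_poly_U_tilde[OF _ q] assms by simp
    also have "\<dots> = (fps_const (1 / fact n) * fps_const (fact n)) * fps_X ^ p * ((1 - fps_X) ^ (n + 1) * B)"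
      by (simp only: mult_ac)
    also have "\<dots> = fps_X ^ p"
      using binomial_series[of n] by (simp add: B_def)
    finally show "fps_of_poly (U_tilde n ?q) = fps_of_poly (monom 1 p)"
      by (simp add: fps_of_poly_monom')
  qed
qed

lemma U_tilde_smult: "U_tilde n (smult a c) = smult a (U_tilde n c)"
  by (rule poly_eqI) (simp add: U_tilde_def coeff_sum sum_distrib_left mult.assoc)

lemma U_tilde_sum: "U_tilde n (\<Sum>p\<in>A. f p) = (\<Sum>p\<in>A. U_tilde n (f p))"
  unfolding U_tilde_def coeff_sum smult_sum by (rule sum.swap)

theorem bij_betw_U_tilde:
  assumes "n \<ge> 1"
  shows "bij_betw (U_tilde n) (polys_below n) (polys_below n)"
proof -
  have "c \<in> U_tilde n ` polys_below n" if c: "c \<in> polys_below n" for c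
  proof -
    define d where
      "d = (\<Sum>p<n. smult (coeff c p) (falling [:-1, 1:] p * rising [:1, 1:] (n - p - 1)))"
    have "d \<in> polys_below n"
      unfolding d_def polys_below_def mem_Collect_eq
    proof (rule degree_sum_le)
      fix p assume "p \<in> {..<n}"
      then show "degree (smult (coeff c p) (falling [:-1, 1:] p * rising [:1, 1:] (n - p - 1))) \<le> n - 1"
        using U_tilde_product_formula(1)[of p n]
        by (intro order_trans[OF degree_smult_le]) (simp add: polys_below_def)
    qed simp
    moreover have "U_tilde n d = (\<Sum>p<n. smult (coeff c p) (monom 1 p))"
      unfolding d_def U_tilde_sum U_tilde_smult by (intro sum.cong) (simp_all only: lessThan_iff U_tilde_product_formula(2))
    moreover have "\<dots> = c"
    proof (rule poly_eqI)
      fix i show "coeff (\<Sum>p<n. smult (coeff c p) (monom 1 p)) i = coeff c i"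
        using c assms
        by (auto simp: coeff_sum coeff_monom if_distrib polys_below_def coeff_eq_0 cong: if_cong)
    qed
    ultimately show ?thesis by force
  qed
  then show ?thesis
    using inj_on_U_tilde[OF assms] U_tilde_closed by (auto simp: bij_betw_def)
qed

corollary U_tilde_inv_monom:
  assumes "p < n"
  shows "U_tilde_inv n (monom 1 p) = falling [:-1, 1:] p * rising [:1, 1:] (n - p - 1)"
  unfolding U_tilde_inv_def
  by (rule inv_into_f_eq[OF inj_on_U_tilde]) (use assms U_tilde_product_formula in auto)

end

(* If c = (1 - x)^(n+1) G with G = sum (j+1) d(j+1) x^j / n!, then W c = (1 - x)^(n+1) H, where
   H keeps every m-th coefficient of G: H_j = G_(mj+m-1).  On the other hand
   w_m^(n+1) c = (1 - x^m)^(n+1) G, and keeping every m-th coefficient turns multiplication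
   by 1 - x^m into multiplication by 1 - x. *)
theory Submission
  imports Defs
begin

text \<open>Multisection of a power series along the residue class \<open>r\<close> modulo
  \<open>m\<close>, reindexed by the quotient \<open>i\<close>.\<close>

definition fps_section :: "nat \<Rightarrow> nat \<Rightarrow> 'a fps \<Rightarrow> 'a fps" where
  "fps_section m r F = Abs_fps (\<lambda>i. F $ (m * i + r))"

lemma fps_section_nth [simp]: "fps_section m r F $ i = F $ (m * i + r)"
  by (simp add: fps_section_def)

text \<open>Shifting by \<open>m\<close> preserves residues modulo \<open>m\<close> and moves the
  quotient \<open>i\<close> by one. At \<open>i = 0\<close> the bound \<open>r < m\<close> ensures
  that \<open>fps_X ^ m * F\<close> contributes nothing at index \<open>r\<close>.\<close>

lemma fps_section_mult_one_minus_X_power: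
  fixes F :: "'a :: comm_ring_1 fps"
  assumes "r < m"
  shows "fps_section m r ((1 - fps_X ^ m) * F) = (1 - fps_X) * fps_section m r F"
proof (rule fps_ext)
  fix i
  show "fps_section m r ((1 - fps_X ^ m) * F) $ i = ((1 - fps_X) * fps_section m r F) $ i"
    using assms by (cases i) (simp_all add: left_diff_distrib fps_X_power_mult_nth)
qed

lemma fps_section_mult_one_minus_X_power_power:
  fixes F :: "'a :: comm_ring_1 fps"
  assumes "r < m"
  shows "fps_section m r ((1 - fps_X ^ m) ^ k * F) = (1 - fps_X) ^ k * fps_section m r F"
  by (induction k) (simp_all add: fps_section_mult_one_minus_X_power[OF assms] mult.assoc)

lemma fps_of_poly_w_poly: "(1 - fps_X) * fps_of_poly (w_poly m) = 1 - fps_X ^ m"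
  by (simp add: w_poly_def fps_of_poly_sum fps_of_poly_monom' one_diff_power_eq)

lemma riordan_in_polys_below:
  assumes "d \<in> polys_below n"
  shows "riordan m d \<in> polys_below n"
proof -
  have "degree (riordan m d) \<le> degree d * degree [:0, of_nat m :: complex:]"
    unfolding riordan_def by (rule order_trans[OF degree_smult_le degree_pcompose_le])
  also have "\<dots> \<le> degree d" by simp
  finally show ?thesis using assms by (simp add: polys_below_def)
qed

lemma coeff_W_map:
  assumes n: "n \<ge> 1" and m: "m \<ge> 1" and c: "c \<in> polys_below n"
  shows "coeff (W_map n m c) i = coeff (w_poly m ^ (n + 1) * c) (m * i + m - 1)"
proof -
  define d where "d = U_tilde_inv n c"
  have d: "d \<in> polys_below n" "U_tilde n d = c"
    using bij_betw_U_tilde[OF n] c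
    by (auto simp: d_def U_tilde_inv_def bij_betw_def inv_into_into f_inv_into_f)
  define G where "G = fps_const (1 / fact n) * Abs_fps (\<lambda>j. (of_nat j + 1) * poly d (of_nat j + 1))"
  have c_eq: "fps_of_poly c = (1 - fps_X) ^ (n + 1) * G"
    using fps_of_poly_U_tilde[OF n d(1)] by (simp add: d(2) G_def mult_ac)
  \<comment> \<open>This singles out the residue \<open>m - 1\<close>: the weight
    \<open>m * (j + 1)\<close> supplies both the scalar \<open>m\<close> of \<open>riordan\<close>
    and the weight \<open>j + 1\<close> of \<open>U_tilde\<close>, while \<open>d\<close> sampled at
    \<open>m * (j + 1)\<close> is \<open>d(mx)\<close> at \<open>j + 1\<close>.\<close>
  have index: "of_nat (m * j + (m - 1)) + 1 = (of_nat m * (of_nat j + 1) :: complex)" for j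
    using m by (simp add: of_nat_diff algebra_simps)
  have "fps_section m (m - 1) G = fps_const (1 / fact n)
      * Abs_fps (\<lambda>j. (of_nat j + 1) * poly (riordan m d) (of_nat j + 1))"
    by (rule fps_ext)
      (simp only: G_def fps_section_nth fps_mult_left_const_nth fps_nth_Abs_fps index,
        simp add: riordan_def poly_pcompose mult_ac)
  then have "fps_of_poly (W_map n m c) = (1 - fps_X) ^ (n + 1) * fps_section m (m - 1) G"
    using fps_of_poly_U_tilde[OF n riordan_in_polys_below[OF d(1)]]
    by (simp add: W_map_def d_def mult_ac)
  also have "\<dots> = fps_section m (m - 1) ((1 - fps_X ^ m) ^ (n + 1) * G)"
    using m by (simp only: fps_section_mult_one_minus_X_power_power)
  \<comment> \<open>Each of the \<open>n + 1\<close> factors \<open>1 - fps_X\<close> in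
    \<open>c\<close> pairs with one factor \<open>w_poly m\<close> to give
    \<open>1 - fps_X ^ m\<close>.\<close>
  also have "(1 - fps_X ^ m) ^ (n + 1) * G = fps_of_poly (w_poly m ^ (n + 1) * c)"
    by (simp only: fps_of_poly_w_poly[symmetric] fps_of_poly_mult fps_of_poly_power c_eq
        power_mult_distrib mult_ac)
  finally have "fps_of_poly (W_map n m c) $ i
      = fps_section m (m - 1) (fps_of_poly (w_poly m ^ (n + 1) * c)) $ i"
    by (rule arg_cong)
  then show ?thesis using m by simp
qed

theorem theorem8p2:
  fixes n m :: nat
  assumes "n \<ge> 1" and "m \<ge> 1"
  shows "(\<forall>c. degree c \<le> n - 1 \<longrightarrow>
            (\<forall>i \<le> n - 1. coeff (W_map n m c) i = coeff (w_poly m ^ (n + 1) * c) (m * i + m - 1)))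
       \<and> (\<forall>i \<le> n - 1. \<forall>j \<le> n - 1.
            coeff (W_map n m (monom 1 j)) i =
              (if j \<le> m * i + m - 1 then coeff (w_poly m ^ (n + 1)) (m * i + m - 1 - j) else 0))"
proof (intro conjI allI impI)
  fix c :: "complex poly" and i
  assume "degree c \<le> n - 1"
  then show "coeff (W_map n m c) i = coeff (w_poly m ^ (n + 1) * c) (m * i + m - 1)"
    using coeff_W_map[OF assms] by (simp add: polys_below_def)
next
  fix i j
  assume "j \<le> n - 1"
  then have "monom 1 j \<in> polys_below n" by (simp add: polys_below_def degree_monom_eq)
  then have "coeff (W_map n m (monom 1 j)) i = coeff (monom 1 j * w_poly m ^ (n + 1)) (m * i + m - 1)"
    by (simp only: coeff_W_map[OF assms] mult.commute)
  \<comment> \<open>Multiplication by \<open>monom 1 j\<close> shifts coefficients by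
    \<open>j\<close>. The case \<open>j > m * i + m - 1\<close> is separate because truncated
    subtraction would pick the constant coefficient of \<open>w_poly m ^ (n + 1)\<close>, which is
    1, instead of 0.\<close>
  then show "coeff (W_map n m (monom 1 j)) i =
      (if j \<le> m * i + m - 1 then coeff (w_poly m ^ (n + 1)) (m * i + m - 1 - j) else 0)"
    by (simp only: coeff_monom_mult) auto
qed

end
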